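(* Let $p, q_1, q_2$ be atoms. Let $\texttt{Split}$ be the inference rule $$\texttt{Split} = \{\langle \langle \mathscr{D} \rangle, (p \rightarrow q_1) \vee (p \rightarrow q_2), \emptyset \rangle \mid \mathscr{D} \text{ an argument structure for } p \rightarrow q_1 \vee q_2\},$$ i.e. the rule with single premise $p \rightarrow q_1 \vee q_2$ and conclusion $(p \rightarrow q_1) \vee (p \rightarrow q_2)$ which discharges nothing. Let $\phi^1$ and $\phi^2$ be the two reductions (defined in the context) acting on certain closed argument structures ending with an application of $\texttt{Split}$. Then $\texttt{Split}$ is logically valid relative to $\mathfrak{H} = \{\phi^1, \phi^2\}$.
   Context: Language. Formulas of $\mathscr{L}$: $A ::= p_1, p_2, \dots \mid \bot \mid A \wedge A \mid A \vee A \mid A \rightarrow A$. Atoms: the $p_i$'s and $\bot$. Atomic rules. Level $0$: an axiom with no premises and an atom $A$ as conclusion. Level $1$: premises atoms $A_1,\dots,A_n$, conclusion an atom $A$. Level $k+2$: premises atoms $A_1,\dots,A_n$, conclusion an atom $A$, where the application may discharge, above premise $A_i$, assumed atomic rules belonging to a finite (possibly empty) set $\Re_i$; $k$ is the maximal level of rules in the $\Re_i$'s. An atomic base is a set $\mathfrak{B} = \{\mathfrak{r}_1,\dots,\mathfrak{r}_n\} \cup \texttt{AE}$, with $\mathfrak{r}_i$ atomic rules and $\texttt{AE}$ the set of all rules with premise $\bot$ and conclusion an atom $A$. $\mathfrak{C}$ is an extension of $\mathfrak{B}$ iff $\mathfrak{C} \supseteq \mathfrak{B}$. Atomic derivations are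 generated inductively: an application of a level-$0$ rule (an axiom node $A$) is an atomic derivation; from atomic derivations of the premises of an atomic rule one obtains an atomic derivation of its conclusion by applying the rule, discharging above the $i$-th premise applications of rules in $\Re_i$. (So all top-nodes are axioms; there are no assumed formulas.) $\texttt{DER}_\mathfrak{B}$ is the set of atomic derivations all of whose applied and undischarged rules belong to $\mathfrak{B}$; $\mathscr{D} \in \texttt{DER}_\mathfrak{B}$ with conclusion $A$ witnesses $\vdash_\mathfrak{B} A$. Argument structures. An argument structure is a pair $\langle T, \langle f,h,g\rangle\rangle$: $T$ is a finite rooted tree with order $\prec$ (towards the root) and nodes labelled by formulas, whose top-nodes are partitioned into assumptions $T^{\texttt{As}}$ and axioms $T^{\texttt{Ax}}$; $f$ (discharge of assumptions) is defined on some $G \subseteq T^{\texttt{As}}$ with $\mu \prec f(\mu)$; $h$ (discharge of level-$0$ rules) is defined on some $H \subseteq T^{\texttt{Ax}}$, where for $\mu \in H$, $\mu$ is labelled by an atom, $\mu \prec h(\mu)$, $h(\mu)$ and its children are labelled by atoms and $h(\mu) \neq f(\nu)$ for all $\nu \in G$; $g$ (discharge of rules of higher level) is defined on some set $J$ of sets $K$ of edges, each $K$ consisting of all and only the edges linking a node $\mu_K$ to its children, with $\mu_K$ and its children labelled by atoms, $\mu_K \neq f(\nu)$ for all $\nu\in G$, $\mu_K \prec g(K)$, $g(K)$ and its children labelled by atoms, and $g(K) \neq f(\nu)$ for all $\nu \in G$. The root label is the conclusion. The structure is closed iff all assumptions are discharged, open otherwise. It is from $\Gamma$ to $A$ (or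 for $A$) if $\Gamma$ is the set of its undischarged assumption-formulas and $A$ its conclusion. Sub-structures and replacement $\mathscr{D}[\mathscr{D}^{**}/\mathscr{D}^*]$ of sub-structures are as usual in Natural Deduction, with discharges readjusted in the obvious way. For $\mathscr{D}$ from $\Gamma=\{A_1,\dots,A_n\}$ and a function $\sigma$ assigning to each $A_i$ an argument structure $\sigma(A_i)$ for $A_i$, $\mathscr{D}^\sigma = \mathscr{D}[\sigma(A_1),\dots,\sigma(A_n)/A_1,\dots,A_n]$. Inferences. An inference is a triple $\langle\langle \mathscr{D}_1,\dots,\mathscr{D}_n\rangle, A, \delta\rangle$, with $\delta$ extending the discharge functions of the $\mathscr{D}_i$'s; its associated argument structure is obtained by joining the $\mathscr{D}_i$'s by a new root $A$, with discharges given by $\delta$ ($\delta=\emptyset$: no new discharges). An inference rule is a set of inferences (its instances), identified with the set of associated argument structures. $\mathscr{D}$ is canonical iff it is associated to an instance of a standard Natural Deduction introduction rule (for $\wedge,\vee,\rightarrow$; $\rightarrow_I$ may discharge vacuously). Reductions. A reduction for an inference rule $\mathscr{R}$ is a constructive (effectively computable) function $\phi$ from argument structures to argument structures, defined on some $\mathbb{D} \subseteq \mathscr{R}$, such that for all $\sigma$: $\mathscr{D}\in\mathbb{D}$ implies $\mathscr{D}^\sigma \in \mathbb{D}$; if $\mathscr{D} \in \mathbb{D}$ is from $\Gamma$ to $A$ then $\phi(\mathscr{D})$ is from some $\Gamma^*\subseteq\Gamma$ to $A$; and $\phi(\mathscr{D}^\sigma)=\phi(\mathscr{D})^\sigma$.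 For a set $\mathfrak{J}$ of reductions, $\mathscr{D}$ immediately reduces to $\mathscr{D}^*$ relative to $\mathfrak{J}$ iff $\mathscr{D}^*=\mathscr{D}[\phi(\mathscr{D}^{**})/\mathscr{D}^{**}]$ for some sub-structure $\mathscr{D}^{**}$ of $\mathscr{D}$ and some $\phi\in\mathfrak{J}$; $\leq_\mathfrak{J}$ is the reflexive-transitive closure. Validity. $\langle\mathscr{D},\mathfrak{J}\rangle$ is valid on $\mathfrak{B}$ iff: (1) if $\mathscr{D}$ is closed with atomic conclusion $A$, then $\mathscr{D}\leq_\mathfrak{J}\mathscr{D}^*$ for some $\mathscr{D}^*$ witnessing $\vdash_\mathfrak{B} A$; (2) if $\mathscr{D}$ is closed with non-atomic conclusion, then $\mathscr{D}\leq_\mathfrak{J}\mathscr{D}^*$ for some canonical $\mathscr{D}^*$ whose immediate sub-structures are valid on $\mathfrak{B}$ when paired with $\mathfrak{J}$; (3) if $\mathscr{D}$ is open with undischarged assumptions $A_1,\dots,A_n$, then for all $\sigma$ (with $\sigma(A_i)$ closed), all sets of reductions $\mathfrak{H}\supseteq\mathfrak{J}$ and all $\mathfrak{C}\supseteq\mathfrak{B}$, if every $\langle\sigma(A_i),\mathfrak{H}\rangle$ is valid on $\mathfrak{C}$, then $\langle\mathscr{D}^\sigma,\mathfrak{H}\rangle$ is valid on $\mathfrak{C}$. Validity of rules. $\mathscr{R}$ is valid relative to $\mathfrak{J}$ on $\mathfrak{B}$ iff for all $\mathfrak{H}\supseteq\mathfrak{J}$, all $\mathfrak{C}\supseteq\mathfrak{B}$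 and every instance $\langle\langle\mathscr{D}_1,\dots,\mathscr{D}_n\rangle,A,\delta\rangle$ of $\mathscr{R}$, if all $\langle\mathscr{D}_i,\mathfrak{H}\rangle$ are valid on $\mathfrak{C}$, then the associated argument structure is valid on $\mathfrak{C}$ when paired with $\mathfrak{H}$. $\mathscr{R}$ is logically valid relative to $\mathfrak{J}$ iff it is valid relative to $\mathfrak{J}$ on every $\mathfrak{B}$. The mappings. $\phi^1$ is defined on the set $\mathbb{D}^1$ of $\langle\langle \mathscr{D}\rangle, (p\rightarrow q_1)\vee(p\rightarrow q_2),\emptyset\rangle$ with $\mathscr{D}$ a closed argument structure for $p\rightarrow q_1\vee q_2$ ending by $\rightarrow_I$ and with open immediate sub-structure $\mathscr{D}^*$ (from $p$ to $q_1\vee q_2$). Its value is obtained by turning into axioms $p$ all the occurrences of assumption $p$ discharged by that $\rightarrow_I$, so that $\rightarrow_I$ now discharges $p$ vacuously, and leaving everything else (including the final $\texttt{Split}$ step) unchanged. $\phi^2$ is defined on the set $\mathbb{D}^2$ of $\langle\langle \mathscr{D}\rangle, (p\rightarrow q_1)\vee(p\rightarrow q_2),\emptyset\rangle$ with $\mathscr{D}$ a closed argument structure for $p\rightarrow q_1\vee q_2$ ending by $\rightarrow_I$, with canonical immediate sub-structure $\mathscr{D}^*$ (ending by $\vee$-introduction from $q_i$ to $q_1\vee q_2$, $i\in\{1,2\}$), whose immediate sub-structure $\mathscr{D}^{**}$ is an atomic derivation (of $q_i$). Its value is obtained as follows: let $\mathscr{D}^{***}$ be $\mathscr{D}^{**}$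 with every undischarged application of axiom $p$ turned into an assumption $p$; apply $\rightarrow_I$ to $\mathscr{D}^{***}$, discharging all these assumptions $p$ (vacuously if there are none), to conclude $p\rightarrow q_i$; then apply $\vee$-introduction to conclude $(p\rightarrow q_1)\vee(p\rightarrow q_2)$. *)

theory Defs
  imports Main "HOL-Library.FSet" "HOL-Library.Nat_Bijection"
begin

datatype atom = Prop nat | Falsum

datatype fm = At atom | And fm fm | Or fm fm | Imp fm fm

fun is_atom :: "fm \<Rightarrow> bool" where
  "is_atom (At a) = True"
| "is_atom _ = False"

text \<open>
  \<open>Rule [(A1, R1), \<dots>, (An, Rn)] A\<close> has premises \<open>A1, \<dots>, An\<close>, conclusion \<open>A\<close>, and may discharge
  above \<open>Ai\<close> the rules in the finite set \<open>Ri\<close>. Level 0 is the case of an empty premise list,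
  level 1 the case where \<open>n \<ge> 1\<close> and all the \<open>Ri\<close> are empty.
\<close>

datatype rule = Rule "(atom \<times> rule fset) list" atom

definition AE :: "rule set" where
  "AE = {Rule [(Falsum, {||})] a | a. True}"

definition atomic_base :: "rule set \<Rightarrow> bool" where
  "atomic_base B \<longleftrightarrow> (\<exists>F. finite F \<and> B = F \<union> AE)"

text \<open>
  \<open>As A d\<close> is a top-node of assumption kind, \<open>Nd A d ts\<close> any other node (an axiom if \<open>ts = []\<close>).
  The three discharge functions are stored in the nodes: \<open>d = Some k\<close> means that the node is mapped
  to its \<open>k\<close>-th proper ancestor, counted towards the root, the parent being number 0; \<open>d = None\<close>
  means that the node is outside the domain. At an \<open>As\<close> node this is the function \<open>f\<close> (discharge of
  assumptions), at \<open>Nd A d []\<close> the function \<open>h\<close> (discharge of axioms), and at \<open>Nd A d ts\<close> with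
  \<open>ts \<noteq> []\<close> the function \<open>g\<close> (discharge of higher-level rules), the set of edges between a node and
  its children being represented by the node itself.
\<close>

datatype tree = As fm "nat option" | Nd fm "nat option" "tree list"

fun concl :: "tree \<Rightarrow> fm" where
  "concl (As A d) = A"
| "concl (Nd A d ts) = A"

text \<open>
  The discharge status, seen from the root of a subtree, of a node at depth \<open>i\<close> in this subtree:
  undischarged, discharged at the \<open>k\<close>-th proper ancestor of the root of the subtree, or
  (empty set) discharged inside the subtree.
\<close>

fun outer :: "nat \<Rightarrow> nat option \<Rightarrow> nat option set" where
  "outer i None = {None}"
| "outer i (Some k) = (if i \<le> k then {Some (k - i)} else {})"

text \<open>
  Assumptions, respectively applications (premises and conclusion) of steps, that are not discharged
  within the given subtree, together with their status. The first argument is the depth, 0 at the root.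
\<close>

fun free_as :: "nat \<Rightarrow> tree \<Rightarrow> (fm \<times> nat option) set" where
  "free_as i (As A d) = {A} \<times> outer i d"
| "free_as i (Nd A d ts) = (\<Union>t\<in>set ts. free_as (Suc i) t)"

fun free_ap :: "nat \<Rightarrow> tree \<Rightarrow> ((fm list \<times> fm) \<times> nat option) set" where
  "free_ap i (As A d) = {}"
| "free_ap i (Nd A d ts) = {(map concl ts, A)} \<times> outer i d \<union> (\<Union>t\<in>set ts. free_ap (Suc i) t)"

definition binds_as :: "tree list \<Rightarrow> fm set" where
  "binds_as ts = {A. \<exists>t\<in>set ts. (A, Some 0) \<in> free_as 0 t}"

definition binds_ap :: "tree list \<Rightarrow> (fm list \<times> fm) set" where
  "binds_ap ts = {r. \<exists>t\<in>set ts. (r, Some 0) \<in> free_ap 0 t}"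

text \<open>
  A node that belongs to the domain or to the range of \<open>h\<close> or \<open>g\<close>, and all its children, are labelled
  by atoms, and the node is not in the range of \<open>f\<close>.
\<close>

fun discharge_ok :: "tree \<Rightarrow> bool" where
  "discharge_ok (As A d) = True"
| "discharge_ok (Nd A d ts) =
    ((\<forall>t\<in>set ts. discharge_ok t) \<and>
     (d \<noteq> None \<or> binds_ap ts \<noteq> {} \<longrightarrow>
        is_atom A \<and> (\<forall>t\<in>set ts. is_atom (concl t)) \<and> binds_as ts = {}))"

definition arg_struct :: "tree \<Rightarrow> bool" where
  "arg_struct D \<longleftrightarrow> discharge_ok D \<and> snd ` free_as 0 D \<subseteq> {None} \<and> snd ` free_ap 0 D \<subseteq> {None}"

definition undischarged :: "tree \<Rightarrow> fm set" where
  "undischarged D = {A. (A, None) \<in> free_as 0 D}"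

definition closed_arg :: "tree \<Rightarrow> bool" where
  "closed_arg D \<longleftrightarrow> undischarged D = {}"

text \<open>
  \<open>release 0 t\<close> is the sub-structure given by a subtree \<open>t\<close>: whatever is discharged below \<open>t\<close>
  becomes undischarged.
\<close>

fun release :: "nat \<Rightarrow> tree \<Rightarrow> tree" where
  "release i (As A d) = As A (if outer i d = {} then d else None)"
| "release i (Nd A d ts) = Nd A (if outer i d = {} then d else None) (map (release (Suc i)) ts)"

fun immediate_subs :: "tree \<Rightarrow> tree list" where
  "immediate_subs (As A d) = []"
| "immediate_subs (Nd A d ts) = map (release 0) ts"

text \<open>
  \<open>\<D>\<^sup>\<sigma>\<close>. For argument structures \<open>\<sigma> A\<close> no index has to be shifted, and nothing in \<open>\<sigma> A\<close> gets
  discharged.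
\<close>

fun subst :: "(fm \<Rightarrow> tree) \<Rightarrow> tree \<Rightarrow> tree" where
  "subst \<sigma> (As A None) = \<sigma> A"
| "subst \<sigma> (As A (Some k)) = As A (Some k)"
| "subst \<sigma> (Nd A d ts) = Nd A d (map (subst \<sigma>) ts)"

definition assignment :: "tree \<Rightarrow> (fm \<Rightarrow> tree) \<Rightarrow> bool" where
  "assignment D \<sigma> \<longleftrightarrow> (\<forall>A\<in>undischarged D. arg_struct (\<sigma> A) \<and> concl (\<sigma> A) = A)"

text \<open>
  \<open>deriv B es t\<close>: the subtree \<open>t\<close> is an atomic derivation whose undischarged rules belong to \<open>B\<close>,
  where \<open>es ! k\<close> is the set of rules that the \<open>k\<close>-th proper ancestor may discharge above the
  premise in question.
\<close>

inductive deriv :: "rule set \<Rightarrow> rule fset list \<Rightarrow> tree \<Rightarrow> bool" for B where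
  step:
    "\<lbrakk> case d of None \<Rightarrow> Rule ps a \<in> B | Some k \<Rightarrow> k < length es \<and> Rule ps a |\<in>| es ! k;
       length ts = length ps;
       \<forall>i<length ps. concl (ts ! i) = At (fst (ps ! i)) \<and> deriv B (snd (ps ! i) # es) (ts ! i) \<rbrakk>
     \<Longrightarrow> deriv B es (Nd (At a) d ts)"

definition DER :: "rule set \<Rightarrow> tree set" where
  "DER B = {D. deriv B [] D}"

definition atomic_derivations :: "tree set" where
  "atomic_derivations = DER UNIV"

text \<open>
  An inference \<open>\<langle>\<langle>\<D>\<^sub>1,\<dots>,\<D>\<^sub>n\<rangle>, A, \<delta>\<rangle>\<close> is identified with its associated argument structure: \<open>A\<close> is the
  conclusion, the \<open>\<D>\<^sub>i\<close> are the immediate sub-structures, and \<open>\<delta>\<close> is given by the discharges at the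
  root.
\<close>

definition inference :: "tree \<Rightarrow> bool" where
  "inference D \<longleftrightarrow> arg_struct D \<and> immediate_subs D \<noteq> []"

definition inference_rule :: "tree set \<Rightarrow> bool" where
  "inference_rule R \<longleftrightarrow> (\<forall>D\<in>R. inference D)"

fun root_binds_as :: "tree \<Rightarrow> fm set" where
  "root_binds_as (As A d) = {}"
| "root_binds_as (Nd A d ts) = binds_as ts"

fun root_binds_ap :: "tree \<Rightarrow> (fm list \<times> fm) set" where
  "root_binds_ap (As A d) = {}"
| "root_binds_ap (Nd A d ts) = binds_ap ts"

definition binds_nothing :: "tree \<Rightarrow> bool" where
  "binds_nothing D \<longleftrightarrow> root_binds_as D = {} \<and> root_binds_ap D = {}"

definition and_intro :: "tree set" where
  "and_intro = {D. inference D \<and> binds_nothing D \<and>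
     (\<exists>A B. concl D = And A B \<and> map concl (immediate_subs D) = [A, B])}"

definition or_intro :: "tree set" where
  "or_intro = {D. inference D \<and> binds_nothing D \<and>
     (\<exists>A B. concl D = Or A B \<and>
        (map concl (immediate_subs D) = [A] \<or> map concl (immediate_subs D) = [B]))}"

definition imp_intro :: "tree set" where
  "imp_intro = {D. inference D \<and> root_binds_ap D = {} \<and>
     (\<exists>A B. concl D = Imp A B \<and> map concl (immediate_subs D) = [B] \<and> root_binds_as D \<subseteq> {A})}"

definition canonical :: "tree \<Rightarrow> bool" where
  "canonical D \<longleftrightarrow> D \<in> and_intro \<union> or_intro \<union> imp_intro"

text \<open>The unary partial recursive functions, with tuples coded by the Cantor pairing function.\<close>

inductive partrec :: "(nat \<Rightarrow> nat option) \<Rightarrow> bool" where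
  zero: "partrec (\<lambda>n. Some 0)"
| succ: "partrec (\<lambda>n. Some (Suc n))"
| left: "partrec (\<lambda>n. Some (fst (prod_decode n)))"
| right: "partrec (\<lambda>n. Some (snd (prod_decode n)))"
| pair: "partrec f \<Longrightarrow> partrec g \<Longrightarrow>
    partrec (\<lambda>n. Option.bind (f n) (\<lambda>a. Option.bind (g n) (\<lambda>b. Some (prod_encode (a, b)))))"
| comp: "partrec f \<Longrightarrow> partrec g \<Longrightarrow> partrec (\<lambda>n. Option.bind (g n) f)"
| prec: "partrec f \<Longrightarrow> partrec g \<Longrightarrow>
    partrec (\<lambda>n. rec_nat (f (fst (prod_decode n)))
      (\<lambda>y r. Option.bind r (\<lambda>v. g (prod_encode (fst (prod_decode n), prod_encode (y, v)))))
      (snd (prod_decode n)))"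
| mu: "partrec f \<Longrightarrow>
    partrec (\<lambda>a. if \<exists>n. f (prod_encode (a, n)) = Some 0 \<and> (\<forall>m<n. f (prod_encode (a, m)) \<noteq> None)
                 then Some (LEAST n. f (prod_encode (a, n)) = Some 0) else None)"

fun code_atom :: "atom \<Rightarrow> nat" where
  "code_atom Falsum = 0"
| "code_atom (Prop n) = Suc n"

fun code_fm :: "fm \<Rightarrow> nat" where
  "code_fm (At a) = prod_encode (0, code_atom a)"
| "code_fm (And A B) = prod_encode (1, prod_encode (code_fm A, code_fm B))"
| "code_fm (Or A B) = prod_encode (2, prod_encode (code_fm A, code_fm B))"
| "code_fm (Imp A B) = prod_encode (3, prod_encode (code_fm A, code_fm B))"

fun code_opt :: "nat option \<Rightarrow> nat" where
  "code_opt None = 0"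
| "code_opt (Some k) = Suc k"

fun code_tree :: "tree \<Rightarrow> nat" where
  "code_tree (As A d) = prod_encode (0, prod_encode (code_fm A, code_opt d))"
| "code_tree (Nd A d ts) =
    prod_encode (1, prod_encode (code_fm A, prod_encode (code_opt d, list_encode (map code_tree ts))))"

definition effective :: "(tree \<Rightarrow> tree option) \<Rightarrow> bool" where
  "effective \<phi> \<longleftrightarrow> (\<exists>g. partrec g \<and>
     (\<forall>D. arg_struct D \<longrightarrow> g (code_tree D) = map_option code_tree (\<phi> D)))"

definition reduction_for :: "tree set \<Rightarrow> (tree \<Rightarrow> tree option) \<Rightarrow> bool" where
  "reduction_for R \<phi> \<longleftrightarrow>
     effective \<phi> \<and> dom \<phi> \<subseteq> R \<and>
     (\<forall>D\<in>dom \<phi>. arg_struct (the (\<phi> D)) \<and> concl (the (\<phi> D)) = concl D \<and>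
        undischarged (the (\<phi> D)) \<subseteq> undischarged D) \<and>
     (\<forall>D\<in>dom \<phi>. \<forall>\<sigma>. assignment D \<sigma> \<longrightarrow>
        subst \<sigma> D \<in> dom \<phi> \<and> the (\<phi> (subst \<sigma> D)) = subst \<sigma> (the (\<phi> D)))"

definition reductions :: "(tree \<Rightarrow> tree option) set \<Rightarrow> bool" where
  "reductions J \<longleftrightarrow> (\<forall>\<phi>\<in>J. \<exists>R. inference_rule R \<and> reduction_for R \<phi>)"

text \<open>
  Readjustment of discharges when the sub-structure \<open>release 0 t\<close>, at the place of the subtree \<open>t\<close>,
  is replaced by \<open>E\<close>. An undischarged assumption of \<open>E\<close> takes over the status of an assumption of
  \<open>t\<close> with the same formula; an undischarged application of a step takes over the status of an
  application in \<open>t\<close> with the same premises and conclusion, and it stays undischarged if there is no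
  such application in \<open>t\<close> or if it discharges assumptions (and is thus not dischargeable).
  Where several occurrences with different statuses are available, every choice is allowed. In
  \<open>readjust t i E E'\<close>, \<open>i\<close> is the depth of \<open>E\<close> in the replacing structure.
\<close>

inductive readjust :: "tree \<Rightarrow> nat \<Rightarrow> tree \<Rightarrow> tree \<Rightarrow> bool" for t where
  assumption_dis: "readjust t i (As A (Some k)) (As A (Some k))"
| assumption_undis: "(A, s) \<in> free_as 0 t \<Longrightarrow> readjust t i (As A None) (As A (map_option ((+) i) s))"
| node_dis: "list_all2 (readjust t (Suc i)) us vs \<Longrightarrow> readjust t i (Nd A (Some k) us) (Nd A (Some k) vs)"
| node_new: "list_all2 (readjust t (Suc i)) us vs \<Longrightarrow>
    (map concl us, A) \<notin> fst ` free_ap 0 t \<or> binds_as us \<noteq> {} \<Longrightarrow>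
    readjust t i (Nd A None us) (Nd A None vs)"
| node_undis: "list_all2 (readjust t (Suc i)) us vs \<Longrightarrow>
    ((map concl us, A), s) \<in> free_ap 0 t \<Longrightarrow> binds_as us = {} \<Longrightarrow>
    readjust t i (Nd A None us) (Nd A (map_option ((+) i) s) vs)"

inductive imm_reduces :: "(tree \<Rightarrow> tree option) set \<Rightarrow> tree \<Rightarrow> tree \<Rightarrow> bool" for J where
  here: "\<phi> \<in> J \<Longrightarrow> \<phi> (release 0 t) = Some E \<Longrightarrow> readjust t 0 E t' \<Longrightarrow> imm_reduces J t t'"
| above: "imm_reduces J t t' \<Longrightarrow> imm_reduces J (Nd A d (us @ t # vs)) (Nd A d (us @ t' # vs))"

abbreviation reduces :: "(tree \<Rightarrow> tree option) set \<Rightarrow> tree \<Rightarrow> tree \<Rightarrow> bool" where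
  "reduces J \<equiv> (imm_reduces J)\<^sup>*\<^sup>*"

lemma finite_outer [simp]: "finite (outer i d)"
  by (cases d) auto

lemma finite_free_as [simp]: "finite (free_as i t)"
  by (induction i t rule: free_as.induct) auto

lemma finite_undischarged [simp]: "finite (undischarged D)"
proof -
  have "undischarged D \<subseteq> fst ` free_as 0 D"
    by (force simp: undischarged_def)
  then show ?thesis
    by (rule finite_subset) simp
qed

lemma concl_release [simp]: "concl (release i t) = concl t"
  by (cases t) auto

lemma free_as_release_None:
  "(A, None) \<in> free_as i (release i t) \<longleftrightarrow> A \<in> fst ` free_as i t"
proof (induction i t rule: free_as.induct)
  case (1 i A' d)
  then show ?case by (cases d) auto
next
  case (2 i A' d ts)
  then show ?case by auto
qed

lemma free_as_Suc:
  "(A, s) \<in> free_as i t \<Longrightarrow> s \<noteq> Some 0 \<Longrightarrow> (A, map_option (\<lambda>k. k - 1) s) \<in> free_as (Suc i) t"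
proof (induction i t rule: free_as.induct)
  case (1 i A' d)
  then show ?case by (cases d) (auto split: if_splits)
next
  case (2 i A' d ts)
  then show ?case by auto
qed

lemma undischarged_immediate:
  assumes "arg_struct D" "E \<in> set (immediate_subs D)"
  shows "undischarged E \<subseteq> undischarged D \<union> root_binds_as D"
proof
  fix A assume A: "A \<in> undischarged E"
  obtain C d ts where D: "D = Nd C d ts" using assms(2) by (cases D) auto
  then obtain t where t: "t \<in> set ts" "E = release 0 t" using assms(2) by auto
  then obtain s where s: "(A, s) \<in> free_as 0 t"
    using A by (auto simp: undischarged_def free_as_release_None)
  show "A \<in> undischarged D \<union> root_binds_as D"
  proof (cases "s = Some 0")
    case True
    then show ?thesis using s t D by (auto simp: binds_as_def)
  next
    case False
    then have "(A, map_option (\<lambda>k. k - 1) s) \<in> free_as 0 D"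
      using free_as_Suc[OF s] t D by auto
    moreover from this have "map_option (\<lambda>k. k - 1) s = None"
      using assms(1) image_subset_iff[of snd "free_as 0 D" "{None}"] unfolding arg_struct_def by fastforce
    ultimately show ?thesis by (simp add: undischarged_def)
  qed
qed

lemma concl_subst:
  assumes "assignment D \<sigma>"
  shows "concl (subst \<sigma> D) = concl D"
  using assms by (cases "(\<sigma>, D)" rule: subst.cases) (auto simp: assignment_def undischarged_def)

lemma free_as_None_Suc: "(A, None) \<in> free_as (Suc i) t \<longleftrightarrow> (A, None) \<in> free_as i t"
proof (induction i t rule: free_as.induct)
  case (1 i A' d)
  then show ?case by (cases d) auto
next
  case (2 i A' d ts)
  then show ?case by auto
qed

lemma undischarged_Nd [simp]: "undischarged (Nd A d ts) = (\<Union>t\<in>set ts. undischarged t)"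
  by (auto simp: undischarged_def free_as_None_Suc)

lemma undischarged_subst:
  "(\<And>A. A \<in> undischarged D \<Longrightarrow> closed_arg (\<sigma> A)) \<Longrightarrow> closed_arg (subst \<sigma> D)"
proof (induction \<sigma> D rule: subst.induct)
  case (1 \<sigma> A)
  then show ?case by (auto simp: undischarged_def)
next
  case (2 \<sigma> A k)
  then show ?case by (auto simp: undischarged_def closed_arg_def)
next
  case (3 \<sigma> A d ts)
  then show ?case by (fastforce simp: closed_arg_def)
qed

definition rank :: "tree \<Rightarrow> nat" where
  "rank D = 2 * Max (insert (size (concl D)) (size ` undischarged D)) + (if closed_arg D then 0 else 1)"

lemma rank_closed: "closed_arg D \<Longrightarrow> rank D = 2 * size (concl D)"
  by (simp add: rank_def closed_arg_def)

lemma rank_open: "\<not> closed_arg D \<Longrightarrow> A \<in> insert (concl D) (undischarged D) \<Longrightarrow> 2 * size A < rank D"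
  unfolding rank_def by (auto simp: less_Suc_eq_le intro!: Max_ge)

lemma rank_le: "(\<And>A. A \<in> insert (concl D) (undischarged D) \<Longrightarrow> size A \<le> n) \<Longrightarrow> rank D \<le> 2 * n + 1"
proof -
  assume "\<And>A. A \<in> insert (concl D) (undischarged D) \<Longrightarrow> size A \<le> n"
  then have "Max (insert (size (concl D)) (size ` undischarged D)) \<le> n"
    by (subst Max_le_iff) auto
  then have "2 * Max (insert (size (concl D)) (size ` undischarged D)) \<le> 2 * n"
    by (rule mult_le_mono2)
  then show ?thesis unfolding rank_def by (rule add_mono) simp
qed

lemma rank_canonical:
  assumes "canonical D" "closed_arg D" "E \<in> set (immediate_subs D)"
  shows "rank E < 2 * size (concl D)"
proof -
  have arg: "arg_struct D" using assms(1) by (auto simp: canonical_def and_intro_def or_intro_def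
      imp_intro_def inference_def)
  have cE: "concl E \<in> set (map concl (immediate_subs D))" using assms(3) by auto
  have und: "undischarged E \<subseteq> root_binds_as D"
    using undischarged_immediate[OF arg assms(3)] assms(2) by (auto simp: closed_arg_def)
  have "rank E \<le> 2 * (size (concl D) - 1) + 1"
  proof (rule rank_le)
    fix A assume "A \<in> insert (concl E) (undischarged E)"
    then show "size A \<le> size (concl D) - 1"
      using assms(1) cE und unfolding canonical_def and_intro_def or_intro_def imp_intro_def
        binds_nothing_def
      by (auto; fastforce)
  qed
  moreover have "size (concl D) > 0"
    using assms(1) by (auto simp: canonical_def and_intro_def or_intro_def imp_intro_def)
  ultimately show ?thesis by linarith
qed

text \<open>
  The requirements \<open>concl D' = concl D\<close> and \<open>closed_arg D'\<close> in the second clause are automatic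
  when \<open>J\<close> is a set of reductions and \<open>D\<close> an argument structure; they make the recursion well-founded
  for arbitrary \<open>J\<close>.
\<close>

context
  notes conj_cong [fundef_cong]
begin

function valid :: "rule set \<Rightarrow> (tree \<Rightarrow> tree option) set \<Rightarrow> tree \<Rightarrow> bool" where
  "valid B J D =
    (if closed_arg D then
       if is_atom (concl D) then \<exists>D'. reduces J D D' \<and> D' \<in> DER B \<and> concl D' = concl D
       else \<exists>D'. (reduces J D D' \<and> concl D' = concl D \<and> closed_arg D' \<and> canonical D') \<and>
              (\<forall>E\<in>set (immediate_subs D'). valid B J E)
     else
       \<forall>\<sigma> H C. assignment D \<sigma> \<and> (\<forall>A\<in>undischarged D. closed_arg (\<sigma> A)) \<and>
         J \<subseteq> H \<and> reductions H \<and> B \<subseteq> C \<and> atomic_base C \<longrightarrow>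
         (\<forall>A\<in>undischarged D. valid C H (\<sigma> A)) \<longrightarrow> valid C H (subst \<sigma> D))"
  by pat_completeness auto
termination
proof (relation "measure (\<lambda>(B, J, D). rank D)", goal_cases)
  case 1
  then show ?case by simp
next
  case (2 B J D D' E)
  then show ?case using rank_canonical[of D' E] by (auto simp: rank_closed)
next
  case (3 B J D \<sigma> H C A)
  then show ?case by (auto simp: assignment_def rank_closed rank_open)
next
  case (4 B J D \<sigma> H C)
  then have "closed_arg (subst \<sigma> D)" using undischarged_subst by blast
  then show ?case using 4 by (auto simp: concl_subst rank_closed rank_open)
qed

end

declare valid.simps [simp del]

definition valid_rule_on :: "rule set \<Rightarrow> tree set \<Rightarrow> (tree \<Rightarrow> tree option) set \<Rightarrow> bool" where
  "valid_rule_on B R J \<longleftrightarrow>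
     (\<forall>H C. J \<subseteq> H \<longrightarrow> reductions H \<longrightarrow> B \<subseteq> C \<longrightarrow> atomic_base C \<longrightarrow>
        (\<forall>D\<in>R. (\<forall>E\<in>set (immediate_subs D). valid C H E) \<longrightarrow> valid C H D))"

definition logically_valid_rule :: "tree set \<Rightarrow> (tree \<Rightarrow> tree option) set \<Rightarrow> bool" where
  "logically_valid_rule R J \<longleftrightarrow> (\<forall>B. atomic_base B \<longrightarrow> valid_rule_on B R J)"

definition Split :: "atom \<Rightarrow> atom \<Rightarrow> atom \<Rightarrow> tree set" where
  "Split p q1 q2 = {D. inference D \<and> binds_nothing D \<and>
     concl D = Or (Imp (At p) (At q1)) (Imp (At p) (At q2)) \<and>
     map concl (immediate_subs D) = [Imp (At p) (Or (At q1) (At q2))]}"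

text \<open>
  Turn into axioms the assumptions of a subtree that are discharged at the parent of its root;
  \<open>i\<close> is the depth, 0 at the root.
\<close>

fun as_to_ax :: "nat \<Rightarrow> tree \<Rightarrow> tree" where
  "as_to_ax i (As A d) = (if d = Some i then Nd A None [] else As A d)"
| "as_to_ax i (Nd A d ts) = Nd A d (map (as_to_ax (Suc i)) ts)"

text \<open>
  Conversely, turn the undischarged applications of the axiom \<open>A\<close> into assumptions discharged at the
  parent of the root.
\<close>

fun ax_to_as :: "fm \<Rightarrow> nat \<Rightarrow> tree \<Rightarrow> tree" where
  "ax_to_as A i (As C d) = As C d"
| "ax_to_as A i (Nd C d ts) =
    (if C = A \<and> d = None \<and> ts = [] then As A (Some i) else Nd C d (map (ax_to_as A (Suc i)) ts))"

fun phi1 :: "atom \<Rightarrow> atom \<Rightarrow> atom \<Rightarrow> tree \<Rightarrow> tree option" where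
  "phi1 p q1 q2 (Nd S d [Nd C e [t]]) =
    (if Nd S d [Nd C e [t]] \<in> Split p q1 q2 \<and> closed_arg (Nd C e [t]) \<and>
        Nd C e [t] \<in> imp_intro \<and> \<not> closed_arg (release 0 t)
     then Some (Nd S d [Nd C e [as_to_ax 0 t]]) else None)"
| "phi1 p q1 q2 _ = None"

definition phi2 :: "atom \<Rightarrow> atom \<Rightarrow> atom \<Rightarrow> tree \<Rightarrow> tree option" where
  "phi2 p q1 q2 D =
    (case immediate_subs D of [D0] \<Rightarrow>
      (case immediate_subs D0 of [D1] \<Rightarrow>
        (case immediate_subs D1 of [D2] \<Rightarrow>
           if D \<in> Split p q1 q2 \<and> closed_arg D0 \<and> D0 \<in> imp_intro \<and> D1 \<in> or_intro \<and>
              D2 \<in> atomic_derivations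
           then Some (Nd (Or (Imp (At p) (At q1)) (Imp (At p) (At q2))) None
                       [Nd (Imp (At p) (concl D2)) None [ax_to_as (At p) 0 D2]])
           else None
         | _ \<Rightarrow> None)
       | _ \<Rightarrow> None)
     | _ \<Rightarrow> None)"

end

theory Submission
  imports Defs
begin

text \<open>
  Reduce the premise of a closed \<open>Split\<close> step to a canonical structure, ending by \<open>\<rightarrow>\<^sub>I\<close> from
  \<open>q\<^sub>1 \<or> q\<^sub>2\<close>. If the assumption \<open>p\<close> is used there, turn it into an axiom by \<open>\<phi>\<^sup>1\<close>: by validity of the
  open structure on the base extended with the axiom \<open>p\<close>, what results reduces to a disjunction
  introduction on top of an atomic derivation of some \<open>q\<^sub>i\<close> in the extended base. Then \<open>\<phi>\<^sup>2\<close> turns the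
  axioms \<open>p\<close> back into assumptions, and the open structure from \<open>p\<close> to \<open>q\<^sub>i\<close> is valid on the original
  base, because every valid closed structure for \<open>p\<close> reduces to an atomic derivation, which can be
  plugged in.
\<close>

section \<open>Discharge and sub-structures\<close>

lemma arg_struct_iff:
  "arg_struct D \<longleftrightarrow> discharge_ok D \<and> (\<forall>x\<in>free_as 0 D. snd x = None) \<and> (\<forall>x\<in>free_ap 0 D. snd x = None)"
  by (auto simp: arg_struct_def)

text \<open>Moving the viewpoint from a subtree to its parent raises the depth by one and lowers
  every finite status by one. This and the next two lemmas transport statuses along an edge.\<close>

lemma free_as_SucD: "(A, s) \<in> free_as (Suc i) t \<Longrightarrow> (A, map_option Suc s) \<in> free_as i t"
proof (induction i t rule: free_as.induct)
  case (1 i A' d)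
  then show ?case by (cases d) (auto simp: Suc_diff_Suc split: if_splits)
qed auto

lemma free_ap_SucD: "(r, s) \<in> free_ap (Suc i) t \<Longrightarrow> (r, map_option Suc s) \<in> free_ap i t"
proof (induction i t rule: free_ap.induct)
  case (2 i A d ts)
  then show ?case by (cases d) (auto simp: Suc_diff_Suc split: if_splits)
qed auto

lemma free_ap_Suc:
  "(r, s) \<in> free_ap i t \<Longrightarrow> s \<noteq> Some 0 \<Longrightarrow> (r, map_option (\<lambda>k. k - 1) s) \<in> free_ap (Suc i) t"
proof (induction i t rule: free_ap.induct)
  case (2 i A d ts)
  then show ?case by (cases d) (auto split: if_splits)
qed auto

text \<open>Only pointers that leave the subtree are erased by \<open>release\<close>, and the
  hypotheses say that there are none.\<close>

lemma release_id:
  "\<lbrakk>\<forall>x\<in>free_as i t. snd x = None; \<forall>x\<in>free_ap i t. snd x = None\<rbrakk> \<Longrightarrow> release i t = t"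
proof (induction i t rule: release.induct)
  case (1 i A d)
  then show ?case by (cases d) (auto split: if_splits)
next
  case (2 i A d ts)
  have "map (release (Suc i)) ts = ts"
  proof (rule map_idI)
    fix t assume "t \<in> set ts"
    then show "release (Suc i) t = t" using 2(2,3) by (intro 2(1)) auto
  qed
  then show ?case using 2(3) by (cases d) (auto split: if_splits)
qed

lemma release_arg_struct: "arg_struct D \<Longrightarrow> release 0 D = D"
  by (simp add: arg_struct_iff release_id)

lemma arg_struct_root: "arg_struct (Nd A d ts) \<Longrightarrow> d = None"
  by (cases d) (auto simp: arg_struct_iff)

text \<open>A finite status is either \<open>Some 0\<close>, excluded since the root discharges no
  steps, or survives decremented as a finite status of the whole structure, where only
  \<open>None\<close> is allowed.\<close>

lemma free_ap_child:
  assumes "arg_struct (Nd A d ts)" "binds_ap ts = {}" "t \<in> set ts" "(r, s) \<in> free_ap 0 t"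
  shows "s = None"
proof -
  have "s \<noteq> Some 0" using assms(2-4) unfolding binds_ap_def by blast
  from free_ap_Suc[OF assms(4) this] have "(r, map_option (\<lambda>k. k - 1) s) \<in> free_ap 0 (Nd A d ts)"
    using assms(3) by auto
  then show ?thesis using assms(1) unfolding arg_struct_iff by fastforce
qed

text \<open>A pointer going beyond the parent of \<open>t\<close> would leave the whole structure,
  so the parent is the only possible target.\<close>

lemma free_as_child:
  assumes "arg_struct (Nd A d ts)" "t \<in> set ts" "(B, s) \<in> free_as 0 t" "s \<noteq> None"
  shows "s = Some 0"
proof (rule ccontr)
  assume "s \<noteq> Some 0"
  from free_as_Suc[OF assms(3) this] have "(B, map_option (\<lambda>k. k - 1) s) \<in> free_as 0 (Nd A d ts)"
    using assms(2) by auto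
  then show False using assms(1,4) unfolding arg_struct_iff by fastforce
qed

lemma arg_struct_child:
  assumes "arg_struct (Nd A d ts)" "binds_as ts = {}" "binds_ap ts = {}" "t \<in> set ts"
  shows "arg_struct t"
proof -
  have "s = None" if "(B, s) \<in> free_as 0 t" for B s
    using free_as_child[OF assms(1,4) that] that assms(2,4) unfolding binds_as_def by blast
  then show ?thesis
    using assms(1,4) free_ap_child[OF assms(1,3,4)] by (auto simp: arg_struct_iff)
qed

lemma binds_arg_structs:
  assumes "\<forall>t\<in>set ts. arg_struct t"
  shows "binds_as ts = {}" "binds_ap ts = {}"
  using assms by (auto simp: binds_as_def binds_ap_def arg_struct_iff; force)+

lemma arg_struct_Nd:
  assumes "\<forall>t\<in>set ts. arg_struct t"
  shows "arg_struct (Nd A None ts)"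
  using assms binds_arg_structs[OF assms]
  by (auto simp: arg_struct_iff; fastforce dest: free_as_SucD free_ap_SucD)

text \<open>The raw subtree \<open>t\<close> is exposed instead of \<open>release 0 t\<close>: its
  assumptions \<open>A\<close> may still point to the implication node, and it is on these pointers
  that \<open>as_to_ax\<close> acts.\<close>

lemma imp_introE:
  assumes "canonical D" "concl D = Imp A B"
  obtains t where "D = Nd (Imp A B) None [t]" "concl t = B" "arg_struct D" "D \<in> imp_intro"
    "binds_ap [t] = {}" "binds_as [t] \<subseteq> {A}"
proof -
  have D: "D \<in> imp_intro"
    using assms by (auto simp: canonical_def and_intro_def or_intro_def)
  then have arg: "arg_struct D" by (auto simp: imp_intro_def inference_def)
  from D assms(2) have m: "map concl (immediate_subs D) = [B]" by (auto simp: imp_intro_def)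
  then obtain C d t where "D = Nd C d [t]" "concl t = B" by (cases D) auto
  moreover from this have "d = None" using arg arg_struct_root by blast
  ultimately show thesis using that[of t] D arg assms(2) by (auto simp: imp_intro_def)
qed

lemma or_introE:
  assumes "canonical D" "concl D = Or A B"
  obtains t where "D = Nd (Or A B) None [t]" "concl t = A \<or> concl t = B" "arg_struct t"
proof -
  have D: "D \<in> or_intro"
    using assms by (auto simp: canonical_def and_intro_def imp_intro_def)
  then have arg: "arg_struct D" and b: "binds_nothing D"
    by (auto simp: or_intro_def inference_def)
  from D assms(2) have m: "map concl (immediate_subs D) = [A] \<or> map concl (immediate_subs D) = [B]"
    by (auto simp: or_intro_def)
  then obtain C d t where t: "D = Nd C d [t]" "concl t = A \<or> concl t = B" by (cases D) auto
  moreover from this have "d = None" using arg arg_struct_root by blast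
  moreover have "arg_struct t" using arg b t by (auto simp: binds_nothing_def intro: arg_struct_child)
  ultimately show thesis using that[of t] assms(2) by auto
qed

lemma SplitE:
  assumes "D \<in> Split p q1 q2"
  obtains t where "D = Nd (Or (Imp (At p) (At q1)) (Imp (At p) (At q2))) None [t]"
    "concl t = Imp (At p) (Or (At q1) (At q2))" "arg_struct t"
proof -
  have arg: "arg_struct D" and b: "binds_nothing D"
    using assms by (auto simp: Split_def inference_def)
  from assms have m: "map concl (immediate_subs D) = [Imp (At p) (Or (At q1) (At q2))]"
    by (auto simp: Split_def)
  then obtain C d t where t: "D = Nd C d [t]" "concl t = Imp (At p) (Or (At q1) (At q2))"
    by (cases D) auto
  moreover from this have "d = None" using arg arg_struct_root by blast
  moreover have "arg_struct t" using arg b t by (auto simp: binds_nothing_def intro: arg_struct_child)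
  ultimately show thesis using that[of t] assms by (auto simp: Split_def)
qed

lemma inference_Nd:
  assumes "arg_struct t"
  shows "inference (Nd A None [t]) \<and> binds_nothing (Nd A None [t]) \<and>
    immediate_subs (Nd A None [t]) = [t] \<and> arg_struct (Nd A None [t])"
  using assms by (simp add: inference_def binds_nothing_def arg_struct_Nd binds_arg_structs
      release_arg_struct)

lemma Split_Nd:
  "\<lbrakk>arg_struct t; concl t = Imp (At p) (Or (At q1) (At q2))\<rbrakk>
    \<Longrightarrow> Nd (Or (Imp (At p) (At q1)) (Imp (At p) (At q2))) None [t] \<in> Split p q1 q2"
  using inference_Nd by (simp add: Split_def)

lemma or_intro_Nd:
  "\<lbrakk>arg_struct t; concl t = A \<or> concl t = B\<rbrakk> \<Longrightarrow> Nd (Or A B) None [t] \<in> or_intro"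
  using inference_Nd by (auto simp: or_intro_def)

lemma imp_intro_Nd:
  "\<lbrakk>arg_struct t; concl t = B\<rbrakk> \<Longrightarrow> Nd (Imp A B) None [t] \<in> imp_intro"
  using inference_Nd by (simp add: imp_intro_def binds_nothing_def)

lemma closed_arg_Nd: "closed_arg (Nd A d [t]) \<longleftrightarrow> closed_arg t"
  by (simp add: closed_arg_def)

section \<open>Reductions\<close>

lemma reduces_child:
  "reduces J t t' \<Longrightarrow> reduces J (Nd A d (us @ t # vs)) (Nd A d (us @ t' # vs))"
  by (induction rule: rtranclp_induct) (auto intro: rtranclp.rtrancl_into_rtrancl imm_reduces.above)

lemma reduces_only_child: "reduces J t t' \<Longrightarrow> reduces J (Nd A d [t]) (Nd A d [t'])"
  using reduces_child[of J t t' A d "[]" "[]"] by simp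

text \<open>The prefix \<open>xs\<close> collects the siblings already treated, so that the children
  can be reduced one after another.\<close>

lemma reduces_children:
  "list_all2 (reduces J) ts us \<Longrightarrow> reduces J (Nd A d (xs @ ts)) (Nd A d (xs @ us))"
proof (induction arbitrary: xs rule: list_all2_induct)
  case (Cons t ts u us)
  have "reduces J (Nd A d (xs @ t # ts)) (Nd A d (xs @ u # ts))"
    using Cons(1) by (rule reduces_child)
  also have "reduces J (Nd A d (xs @ u # ts)) (Nd A d (xs @ u # us))"
    using Cons(3)[of "xs @ [u]"] by simp
  finally show ?case .
qed simp

lemma reduces_subst:
  "(\<And>A. A \<in> undischarged t \<Longrightarrow> reduces J (\<sigma> A) (\<tau> A)) \<Longrightarrow> reduces J (subst \<sigma> t) (subst \<tau> t)"
proof (induction \<sigma> t rule: subst.induct)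
  case (1 \<sigma> A)
  then show ?case by (simp add: undischarged_def)
next
  case (3 \<sigma> A d ts)
  have "list_all2 (reduces J) (map (subst \<sigma>) ts) (map (subst \<tau>) ts)"
    unfolding list_all2_map1 list_all2_map2 by (rule list.rel_refl_strong) (use 3 in auto)
  from reduces_children[OF this, of A d "[]"] show ?case by simp
qed simp

text \<open>A closed \<open>E\<close> has no undischarged assumption to rebind, and an application
  of a step in \<open>E\<close> can only inherit a status from \<open>t\<close>, which is
  \<open>None\<close> because \<open>t\<close> is an argument structure. Hence \<open>E\<close> may
  be put in place of \<open>t\<close> unchanged.\<close>

lemma readjust_closed:
  assumes "arg_struct t"
  shows "closed_arg E \<Longrightarrow> readjust t i E E"
proof (induction E arbitrary: i)
  case (As A d)
  then show ?case
    by (cases d) (auto simp: closed_arg_def undischarged_def intro: readjust.assumption_dis)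
next
  case (Nd A d us)
  have us: "list_all2 (readjust t (Suc i)) us us"
    using Nd by (auto simp: list_all2_conv_all_nth closed_arg_def)
  show ?case
  proof (cases d)
    case (Some k)
    then show ?thesis using us by (auto intro: readjust.node_dis)
  next
    case None
    show ?thesis
    proof (cases "(map concl us, A) \<notin> fst ` free_ap 0 t \<or> binds_as us \<noteq> {}")
      case True
      then show ?thesis using us None by (auto intro: readjust.node_new)
    next
      case False
      then obtain s where s: "((map concl us, A), s) \<in> free_ap 0 t" "binds_as us = {}" by force
      then have "s = None" using assms by (force simp: arg_struct_iff)
      then show ?thesis using readjust.node_undis[OF us s] None by simp
    qed
  qed
qed

lemma reduces_root:
  assumes "arg_struct t" "\<phi> \<in> J" "\<phi> t = Some E" "closed_arg E"
  shows "reduces J t E"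
proof -
  have "imm_reduces J t E"
    using assms readjust_closed by (auto intro: imm_reduces.here simp: release_arg_struct)
  then show ?thesis by blast
qed

text \<open>Links \<open>phi1\<close> to the validity clause for open structures: turning the
  discharged assumptions into axioms is the same as releasing them and substituting the axiom for
  them.\<close>

lemma subst_release_as_to_ax:
  "\<lbrakk>free_as i t \<subseteq> {(A, Some 0)}; \<forall>x\<in>free_ap i t. snd x = None\<rbrakk>
    \<Longrightarrow> subst (\<lambda>_. Nd A None []) (release i t) = as_to_ax i t"
proof (induction i t rule: release.induct)
  case (1 i B d)
  then show ?case by (cases d) (auto split: if_splits)
next
  case (2 i B d ts)
  have "map (subst (\<lambda>_. Nd A None []) \<circ> release (Suc i)) ts = map (as_to_ax (Suc i)) ts"
  proof (intro map_cong refl)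
    fix t assume "t \<in> set ts"
    then show "(subst (\<lambda>_. Nd A None []) \<circ> release (Suc i)) t = as_to_ax (Suc i) t"
      unfolding comp_def using 2(2,3) by (intro 2(1)) auto
  qed
  then show ?case using 2(3) by (cases d) (auto split: if_splits)
qed

lemma subst_id [simp]: "subst (\<lambda>A. As A None) t = t"
  by (induction "\<lambda>A. As A None" t rule: subst.induct) (auto intro: map_idI)

section \<open>Atomic derivations\<close>

text \<open>Discharge indices count from the nearest ancestor, so appending remote ancestors
  \<open>es'\<close> disturbs none of them.\<close>

lemma deriv_mono: "deriv B es t \<Longrightarrow> B \<subseteq> C \<Longrightarrow> deriv C (es @ es') t"
proof (induction rule: deriv.induct)
  case (step d ps a es ts)
  then show ?case
    by (intro deriv.step[where ps = ps]) (auto simp: nth_append split: option.splits)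
qed

lemma DER_mono: "B \<subseteq> C \<Longrightarrow> DER B \<subseteq> DER C"
  using deriv_mono[of B "[]" _ C "[]"] by (auto simp: DER_def)

lemma deriv_free_as: "deriv B es t \<Longrightarrow> free_as i t = {}"
proof (induction arbitrary: i rule: deriv.induct)
  case (step d ps a es ts)
  then show ?case by (auto simp: in_set_conv_nth)
qed

text \<open>Indices are below \<open>length es\<close>, so at depth at least
  \<open>length es\<close> they all point to nodes inside the tree.\<close>

lemma deriv_free_ap: "deriv B es t \<Longrightarrow> length es \<le> i \<Longrightarrow> x \<in> free_ap i t \<Longrightarrow> snd x = None"
proof (induction arbitrary: i rule: deriv.induct)
  case (step d ps a es ts)
  from step.prems(2) consider "x \<in> {(map concl ts, At a)} \<times> outer i d"
    | j where "j < length ts" "x \<in> free_ap (Suc i) (ts ! j)"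
    by (auto simp: in_set_conv_nth)
  then show ?case
  proof cases
    case 1
    then show ?thesis using step.hyps(1) step.prems(1) by (auto split: option.splits if_splits)
  next
    case (2 j)
    then show ?thesis using step.hyps(2) step.IH step.prems(1) by auto
  qed
qed

lemma deriv_discharge_ok: "deriv B es t \<Longrightarrow> discharge_ok t \<and> is_atom (concl t)"
proof (induction rule: deriv.induct)
  case (step d ps a es ts)
  have "discharge_ok t \<and> is_atom (concl t) \<and> free_as 0 t = {}" if t: "t \<in> set ts" for t
  proof -
    obtain j where "j < length ps" "t = ts ! j"
      using t step(2) by (metis in_set_conv_nth)
    with step(3) show ?thesis using deriv_free_as by auto
  qed
  then show ?case by (auto simp: binds_as_def)
qed

lemma DER_arg_struct: "D \<in> DER B \<Longrightarrow> arg_struct D"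
  using deriv_free_ap[of B "[]" D 0] by (auto simp: DER_def arg_struct_iff deriv_discharge_ok deriv_free_as)

lemma DER_closed: "D \<in> DER B \<Longrightarrow> closed_arg D"
  by (auto simp: DER_def closed_arg_def undischarged_def deriv_free_as)

section \<open>Turning axioms of an atomic derivation back into assumptions\<close>

lemma concl_ax_to_as [simp]: "concl (ax_to_as A i t) = concl t"
  by (cases t) auto

text \<open>An atomic derivation has no assumptions, so the only ones are those created by
  \<open>ax_to_as\<close>, all pointing to the parent of the root at which the depth
  \<open>i\<close> starts from 0.\<close>

lemma free_as_ax_to_as:
  "deriv B es t \<Longrightarrow> free_as j (ax_to_as A i t) \<subseteq> {A} \<times> outer j (Some i)"
proof (induction arbitrary: i j rule: deriv.induct)
  case (step d ps a es ts)
  have "free_as (Suc j) (ax_to_as A (Suc i) t) \<subseteq> {A} \<times> outer j (Some i)" if t: "t \<in> set ts" for t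
  proof -
    obtain k where "k < length ps" "t = ts ! k"
      using t step(2) by (metis in_set_conv_nth)
    with step(3) have "free_as (Suc j) (ax_to_as A (Suc i) t) \<subseteq> {A} \<times> outer (Suc j) (Some (Suc i))"
      by blast
    moreover have "outer (Suc j) (Some (Suc i)) = outer j (Some i)" by simp
    ultimately show ?thesis by (simp only:)
  qed
  then show ?case by (auto split: if_splits) blast+
qed

lemma free_ap_ax_to_as: "free_ap j (ax_to_as A i t) \<subseteq> free_ap j t"
proof (induction A i t arbitrary: j rule: ax_to_as.induct)
  case (2 A i C d ts)
  then show ?case by (auto simp: comp_def split: if_splits) blast+
qed simp

lemma discharge_ok_ax_to_as: "deriv B es t \<Longrightarrow> discharge_ok (ax_to_as A i t)"
proof (induction arbitrary: i rule: deriv.induct)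
  case (step d ps a es ts)
  have t: "discharge_ok (ax_to_as A (Suc i) t) \<and> is_atom (concl t) \<and>
      (C, Some 0) \<notin> free_as 0 (ax_to_as A (Suc i) t)" if t: "t \<in> set ts" for t C
  proof -
    obtain j where j: "j < length ps" "t = ts ! j"
      using t step(2) by (metis in_set_conv_nth)
    with step(3) have "deriv B (snd (ps ! j) # es) t" by blast
    \<comment> \<open>The status is \<open>Some (Suc i)\<close>, never \<open>Some 0\<close>: the
      new assumptions are discharged outside the derivation, hence at no node that also discharges
      rules.\<close>
    then have "free_as 0 (ax_to_as A (Suc i) t) \<subseteq> {A} \<times> outer 0 (Some (Suc i))"
      by (rule free_as_ax_to_as)
    with j step(3) show ?thesis by auto
  qed
  then show ?case by (auto simp: binds_as_def)
qed

lemma arg_struct_imp_ax_to_as: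
  assumes "D \<in> DER B"
  shows "arg_struct (Nd C None [ax_to_as A 0 D])" "closed_arg (Nd C None [ax_to_as A 0 D])"
    "binds_ap [ax_to_as A 0 D] = {}" "binds_as [ax_to_as A 0 D] \<subseteq> {A}"
proof -
  have D: "deriv B [] D" using assms by (simp add: DER_def)
  have as1: "free_as (Suc 0) (ax_to_as A 0 D) = {}"
    using free_as_ax_to_as[OF D, of "Suc 0" A 0] by auto
  have ap: "snd x = None" if "x \<in> free_ap i (ax_to_as A 0 D)" for x i
    using that free_ap_ax_to_as deriv_free_ap[OF D, of i x] by fastforce
  show b: "binds_ap [ax_to_as A 0 D] = {}"
    using ap[of _ 0] by (force simp: binds_ap_def)
  show "binds_as [ax_to_as A 0 D] \<subseteq> {A}"
    using free_as_ax_to_as[OF D, of 0 A 0] by (auto simp: binds_as_def)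
  show "arg_struct (Nd C None [ax_to_as A 0 D])"
    using as1 ap[of _ "Suc 0"] b discharge_ok_ax_to_as[OF D] by (auto simp: arg_struct_iff)
  show "closed_arg (Nd C None [ax_to_as A 0 D])"
    using as1 by (auto simp: closed_arg_def undischarged_def)
qed

lemma imp_intro_ax_to_as:
  assumes "D \<in> DER B"
  shows "Nd (Imp A (concl D)) None [ax_to_as A 0 D] \<in> imp_intro"
  using arg_struct_imp_ax_to_as[OF assms]
  by (auto simp: imp_intro_def inference_def)

text \<open>
  The undischarged axioms \<open>p\<close> of a derivation are replaced by derivations of \<open>p\<close>. The hypothesis on
  \<open>\<tau>\<close> is void when there are no such axioms: taking for \<open>\<tau>\<close> the identity substitution then shows
  that the derivation itself does not need the axiom rule.
\<close>

lemma deriv_subst_ax_to_as: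
  assumes "deriv (insert (Rule [] p) B) es t" "length es = i"
    and "\<And>A. A \<in> undischarged (release i (ax_to_as (At p) i t)) \<Longrightarrow> deriv B [] (\<tau> A) \<and> concl (\<tau> A) = A"
  shows "deriv B es (subst \<tau> (release i (ax_to_as (At p) i t))) \<and>
    concl (subst \<tau> (release i (ax_to_as (At p) i t))) = concl t"
  using assms
proof (induction arbitrary: i rule: deriv.induct)
  case (step d ps a es ts)
  show ?case
  proof (cases "a = p \<and> d = None \<and> ts = []")
    \<comment> \<open>An axiom \<open>p\<close> has become an assumption, and \<open>\<tau>\<close>
      puts a derivation of \<open>p\<close> in its place, which is weakened from \<open>[]\<close>
      to \<open>es\<close>.\<close>
    case True
    then show ?thesis
      using step.prems(2)[of "At p"] deriv_mono[of B "[]" "\<tau> (At p)" B es]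
      by (auto simp: undischarged_def)
  next
    case False
    let ?f = "\<lambda>t. subst \<tau> (release (Suc i) (ax_to_as (At p) (Suc i) t))"
    have ax: "ax_to_as (At p) i (Nd (At a) d ts) = Nd (At a) d (map (ax_to_as (At p) (Suc i)) ts)"
      using False by (cases d) auto
    \<comment> \<open>A discharge index of the derivation is below \<open>length es = i\<close>, so
      it points inside the tree and \<open>release\<close> keeps it.\<close>
    have d: "(if outer i d = {} then d else None) = d"
      using step(1) step.prems(1) by (cases d) auto
    have f: "concl (?f (ts ! j)) = At (fst (ps ! j)) \<and> deriv B (snd (ps ! j) # es) (?f (ts ! j))"
      if "j < length ps" for j
    proof -
      have "ts ! j \<in> set ts" using that step(2) by simp
      then have "\<And>A. A \<in> undischarged (release (Suc i) (ax_to_as (At p) (Suc i) (ts ! j))) \<Longrightarrow>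
          deriv B [] (\<tau> A) \<and> concl (\<tau> A) = A"
        by (intro step.prems(2)) (auto simp: ax)
      then show ?thesis using step(3) that step.prems(1) by auto
    qed
    \<comment> \<open>An undischarged rule here already lies in \<open>B\<close>: using the added
      axiom would force \<open>a = p\<close> and \<open>ts = []\<close>, which is excluded in this
      case.\<close>
    have "deriv B es (Nd (At a) d (map ?f ts))"
      by (rule deriv.step[where ps = ps]) (use step(1,2) False f in \<open>auto split: option.splits\<close>)
    then show ?thesis unfolding ax using d by (simp add: comp_def)
  qed
qed

section \<open>Validity\<close>

lemma valid_closed_atomE:
  assumes "valid B J D" "closed_arg D" "concl D = At a"
  obtains D' where "reduces J D D'" "D' \<in> DER B" "concl D' = At a"
  using assms by (auto simp: valid.simps[of B J D])

lemma valid_closedE: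
  assumes "valid B J D" "closed_arg D" "\<not> is_atom (concl D)"
  obtains D' where "reduces J D D'" "concl D' = concl D" "closed_arg D'" "canonical D'"
    "\<forall>E\<in>set (immediate_subs D'). valid B J E"
  using assms by (auto simp: valid.simps[of B J D])

lemma valid_closedI:
  assumes "closed_arg D" "\<not> is_atom (concl D)" "reduces J D D'" "concl D' = concl D"
    "closed_arg D'" "canonical D'" "\<forall>E\<in>set (immediate_subs D'). valid B J E"
  shows "valid B J D"
  using assms by (subst valid.simps) auto

lemma valid_DER:
  "\<lbrakk>D \<in> DER B; reduces J E D; closed_arg E; concl E = At a; concl D = At a\<rbrakk> \<Longrightarrow> valid B J E"
  by (subst valid.simps) auto

lemma valid_ax_to_as:
  assumes D: "D \<in> DER (insert (Rule [] p) B)" and q: "concl D = At q"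
  shows "valid B J (release 0 (ax_to_as (At p) 0 D))" (is "valid B J ?u")
proof -
  have der: "deriv (insert (Rule [] p) B) [] D" using D by (simp add: DER_def)
  have und: "undischarged ?u \<subseteq> {At p}"
    using free_as_ax_to_as[OF der, of 0 "At p" 0] by (auto simp: undischarged_def free_as_release_None)
  show ?thesis
  proof (cases "closed_arg ?u")
    case True
    then have "deriv B [] (subst (\<lambda>A. As A None) ?u)"
      by (intro deriv_subst_ax_to_as[OF der, THEN conjunct1]) (auto simp: closed_arg_def)
    then show ?thesis using True q by (intro valid_DER[of ?u]) (auto simp: DER_def)
  next
    case False
    then have und: "undischarged ?u = {At p}" using und by (auto simp: closed_arg_def)
    have "valid C H (subst \<sigma> ?u)"
      if \<sigma>: "assignment ?u \<sigma>" "closed_arg (\<sigma> (At p))" "valid C H (\<sigma> (At p))" and C: "B \<subseteq> C" for \<sigma> H C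
    proof -
      have "concl (\<sigma> (At p)) = At p" using \<sigma>(1) und by (simp add: assignment_def)
      \<comment> \<open>Validity for an atom yields an atomic derivation \<open>s\<close> of
        \<open>p\<close> over the extension \<open>C\<close>; it is plugged in for \<open>p\<close>,
        and the reductions from \<open>\<sigma> (At p)\<close> to \<open>s\<close> are carried out
        in every copy.\<close>
      with \<sigma> obtain s where s: "reduces H (\<sigma> (At p)) s" "s \<in> DER C" "concl s = At p"
        by (auto elim: valid_closed_atomE)
      have "deriv (insert (Rule [] p) C) [] D" using deriv_mono[OF der, of _ "[]"] C by auto
      then have "deriv C [] (subst (\<lambda>_. s) ?u) \<and> concl (subst (\<lambda>_. s) ?u) = concl D"
        by (rule deriv_subst_ax_to_as) (use und s in \<open>auto simp: DER_def\<close>)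
      moreover have "reduces H (subst \<sigma> ?u) (subst (\<lambda>_. s) ?u)"
        by (rule reduces_subst) (use und s in auto)
      moreover have "closed_arg (subst \<sigma> ?u)"
        by (rule undischarged_subst) (use und \<sigma> in auto)
      ultimately show ?thesis
        using q concl_subst[OF \<sigma>(1)] by (intro valid_DER[of "subst (\<lambda>_. s) ?u"]) (auto simp: DER_def)
    qed
    then show ?thesis using False und by (subst valid.simps) auto
  qed
qed

text \<open>\<open>V\<close> is the immediate sub-structure of the value of \<open>phi2\<close>. It
  is canonical already, so validity needs no reduction and comes down to that of its premise over
  \<open>B\<close>, without the axiom \<open>p\<close>.\<close>

lemma valid_Split_result:
  assumes D: "D \<in> DER (insert (Rule [] p) B)" and q: "concl D = At q1 \<or> concl D = At q2"
  defines "V \<equiv> Nd (Imp (At p) (concl D)) None [ax_to_as (At p) 0 D]"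
  shows "arg_struct V" "closed_arg V" "concl V = Imp (At p) (concl D)" "valid B J V"
proof -
  show V: "arg_struct V" "closed_arg V" "concl V = Imp (At p) (concl D)"
    unfolding V_def by (auto intro: arg_struct_imp_ax_to_as[OF D])
  have "V \<in> imp_intro" unfolding V_def by (rule imp_intro_ax_to_as[OF D])
  then show "valid B J V"
    using V valid_ax_to_as[OF D] q
    by (intro valid_closedI[of V J V]) (auto simp: canonical_def, auto simp: V_def)
qed

text \<open>The clause for compound conclusions gives a disjunction introduction; its premise is
  closed with an atomic conclusion and is reduced in place to an atomic derivation.\<close>

lemma valid_Or_atomsE:
  assumes "valid B J t" "closed_arg t" "concl t = Or (At q1) (At q2)"
  obtains s where "reduces J t (Nd (Or (At q1) (At q2)) None [s])" "s \<in> DER B"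
    "concl s = At q1 \<or> concl s = At q2"
proof -
  from assms obtain t' where t': "reduces J t t'" "concl t' = Or (At q1) (At q2)" "closed_arg t'"
    "canonical t'" "\<forall>E\<in>set (immediate_subs t'). valid B J E"
    by (auto elim: valid_closedE)
  from or_introE[OF t'(4,2)] obtain r where r: "t' = Nd (Or (At q1) (At q2)) None [r]"
    "concl r = At q1 \<or> concl r = At q2" "arg_struct r" .
  then have "valid B J r" "closed_arg r"
    using t'(3,5) by (auto simp: release_arg_struct closed_arg_Nd)
  then obtain s where s: "reduces J r s" "s \<in> DER B" "concl s = concl r"
    using r(2) by (metis valid_closed_atomE)
  have "reduces J t' (Nd (Or (At q1) (At q2)) None [s])"
    using s(1) r(1) by (simp add: reduces_only_child)
  with t'(1) s r(2) show thesis by (intro that[of s]) auto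
qed

lemma atomic_base_insert: "atomic_base B \<Longrightarrow> atomic_base (insert r B)"
  unfolding atomic_base_def by (metis Un_insert_left finite_insert)

lemma valid_axiom: "Rule [] p \<in> B \<Longrightarrow> valid B J (Nd (At p) None [])"
proof -
  assume "Rule [] p \<in> B"
  then have "Nd (At p) None [] \<in> DER B"
    by (auto simp: DER_def intro: deriv.step[where ps = "[]"])
  then show ?thesis by (rule valid_DER) (auto simp: closed_arg_def)
qed

section \<open>The two reductions on a closed \<open>Split\<close> step\<close>

lemma phi1_reduces:
  assumes "phi1 p q1 q2 \<in> H" and E: "E = Nd (Imp (At p) (Or (At q1) (At q2))) None [t]"
    "arg_struct E" "E \<in> imp_intro" "closed_arg E" "\<not> closed_arg (release 0 t)"
    and "closed_arg (as_to_ax 0 t)"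
  shows "reduces H (Nd (Or (Imp (At p) (At q1)) (Imp (At p) (At q2))) None [E])
    (Nd (Or (Imp (At p) (At q1)) (Imp (At p) (At q2))) None
      [Nd (Imp (At p) (Or (At q1) (At q2))) None [as_to_ax 0 t]])"
proof (rule reduces_root[OF _ assms(1)])
  show "arg_struct (Nd (Or (Imp (At p) (At q1)) (Imp (At p) (At q2))) None [E])"
    using E(2) by (simp add: arg_struct_Nd)
  have "Nd (Or (Imp (At p) (At q1)) (Imp (At p) (At q2))) None [E] \<in> Split p q1 q2"
    using E(1,2) by (intro Split_Nd) auto
  with E show "phi1 p q1 q2 (Nd (Or (Imp (At p) (At q1)) (Imp (At p) (At q2))) None [E]) =
    Some (Nd (Or (Imp (At p) (At q1)) (Imp (At p) (At q2))) None
      [Nd (Imp (At p) (Or (At q1) (At q2))) None [as_to_ax 0 t]])"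
    by simp
qed (use assms(7) in \<open>simp add: closed_arg_Nd\<close>)

lemma phi2_reduces:
  assumes "phi2 p q1 q2 \<in> H" and s: "s \<in> DER B" "concl s = At q1 \<or> concl s = At q2"
  shows "reduces H
    (Nd (Or (Imp (At p) (At q1)) (Imp (At p) (At q2))) None
      [Nd (Imp (At p) (Or (At q1) (At q2))) None [Nd (Or (At q1) (At q2)) None [s]]])
    (Nd (Or (Imp (At p) (At q1)) (Imp (At p) (At q2))) None
      [Nd (Imp (At p) (concl s)) None [ax_to_as (At p) 0 s]])" (is "reduces H ?W ?V")
proof (rule reduces_root[OF _ assms(1)])
  let ?D1 = "Nd (Or (At q1) (At q2)) None [s]"
  let ?D0 = "Nd (Imp (At p) (Or (At q1) (At q2))) None [?D1]"
  have arg: "arg_struct s" "arg_struct ?D1" "arg_struct ?D0" "arg_struct ?W"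
    using DER_arg_struct[OF s(1)] by (auto intro!: arg_struct_Nd)
  then show "arg_struct ?W" by simp
  have subs: "immediate_subs ?W = [?D0]" "immediate_subs ?D0 = [?D1]" "immediate_subs ?D1 = [s]"
    using arg inference_Nd by blast+
  have "?W \<in> Split p q1 q2" by (rule Split_Nd[OF arg(3)]) simp
  moreover have "?D0 \<in> imp_intro" by (rule imp_intro_Nd[OF arg(2)]) simp
  moreover have "?D1 \<in> or_intro" by (rule or_intro_Nd[OF arg(1) s(2)])
  moreover have "closed_arg ?D0" using DER_closed[OF s(1)] by (simp add: closed_arg_Nd)
  \<comment> \<open>The domain of \<open>phi2\<close> does not depend on a base, so the base of
    \<open>s\<close> is enlarged to \<open>UNIV\<close>.\<close>
  moreover have "s \<in> atomic_derivations"
    using s(1) DER_mono[of B UNIV] by (auto simp: atomic_derivations_def)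
  ultimately show "phi2 p q1 q2 ?W = Some ?V"
    unfolding phi2_def subs list.case by simp
  show "closed_arg ?V"
    using arg_struct_imp_ax_to_as(2)[OF s(1)] by (simp add: closed_arg_Nd)
qed

lemma valid_Split_closed:
  assumes H: "reductions H" "phi1 p q1 q2 \<in> H" "phi2 p q1 q2 \<in> H" and B: "atomic_base B"
    and E: "valid B H E" "closed_arg E" "concl E = Imp (At p) (Or (At q1) (At q2))"
  shows "valid B H (Nd (Or (Imp (At p) (At q1)) (Imp (At p) (At q2))) None [E])"
proof -
  let ?S = "Or (Imp (At p) (At q1)) (Imp (At p) (At q2))"
  let ?I = "Imp (At p) (Or (At q1) (At q2))"
  let ?Bp = "insert (Rule [] p) B"
  from E obtain E' where E': "reduces H E E'" "concl E' = ?I" "closed_arg E'" "canonical E'"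
    "\<forall>F\<in>set (immediate_subs E'). valid B H F"
    by (auto elim: valid_closedE)
  from imp_introE[OF E'(4,2)] obtain t where t: "E' = Nd ?I None [t]" "concl t = Or (At q1) (At q2)"
    "arg_struct E'" "E' \<in> imp_intro" "binds_ap [t] = {}" "binds_as [t] \<subseteq> {At p}" .
  have val: "valid B H (release 0 t)" using E'(5) t(1) by simp
  \<comment> \<open>Closedness of \<open>E'\<close> excludes undischarged assumptions, the only node
    below \<open>t\<close> is the implication, and that one discharges only
    \<open>p\<close>.\<close>
  have as: "free_as 0 t \<subseteq> {(At p, Some 0)}"
  proof
    fix x assume "x \<in> free_as 0 t"
    then obtain A s where x: "x = (A, s)" and s: "(A, s) \<in> free_as 0 t" by (cases x) auto
    have "s \<noteq> None" using s E'(3)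
      unfolding t(1) closed_arg_Nd by (cases s) (auto simp: closed_arg_def undischarged_def)
    then have "s = Some 0" using free_as_child[of ?I None "[t]"] t(1,3) s by auto
    then show "x \<in> {(At p, Some 0)}" using x s t(6) by (auto simp: binds_as_def)
  qed
  have ap: "\<forall>x\<in>free_ap 0 t. snd x = None"
    using free_ap_child[of ?I None "[t]" t] t by auto
  \<comment> \<open>Common shape of both cases: \<open>r\<close> is \<open>t\<close> itself if the
    implication discharges vacuously, and \<open>as_to_ax 0 t\<close> after a step by
    \<open>phi1\<close> otherwise.\<close>
  have "\<exists>r. reduces H (Nd ?S None [E']) (Nd ?S None [Nd ?I None [r]]) \<and>
      (\<exists>s. reduces H r (Nd (Or (At q1) (At q2)) None [s]) \<and> s \<in> DER ?Bp \<and>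
        (concl s = At q1 \<or> concl s = At q2))"
  proof (cases "closed_arg (release 0 t)")
    case True
    then have "free_as 0 t = {}"
      by (force simp: closed_arg_def undischarged_def free_as_release_None)
    then have "release 0 t = t" using ap by (intro release_id) auto
    with val True have "valid B H t" "closed_arg t" by simp_all
    then obtain s where "reduces H t (Nd (Or (At q1) (At q2)) None [s])" "s \<in> DER B"
      "concl s = At q1 \<or> concl s = At q2"
      using t(2) by (rule valid_Or_atomsE)
    then show ?thesis
      using t(1) DER_mono[OF subset_insertI, of B "Rule [] p"] by blast
  next
    case False
    let ?\<sigma> = "\<lambda>_. Nd (At p) None []"
    have r: "subst ?\<sigma> (release 0 t) = as_to_ax 0 t" using as ap by (rule subst_release_as_to_ax)
    have und: "undischarged (release 0 t) \<subseteq> {At p}"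
      using as by (auto simp: undischarged_def free_as_release_None)
    have cl: "closed_arg (Nd (At p) None [])" by (simp add: closed_arg_def)
    have \<sigma>: "assignment (release 0 t) ?\<sigma>"
      using und by (auto simp: assignment_def arg_struct_Nd)
    \<comment> \<open>The open clause over \<open>B\<close> is instantiated with the extension
      \<open>?Bp\<close>, in which the bare axiom \<open>p\<close> is a valid closed
      structure.\<close>
    have "valid ?Bp H (subst ?\<sigma> (release 0 t))"
      using val False \<sigma> cl H(1) atomic_base_insert[OF B] valid_axiom[of p ?Bp H]
      by (subst (asm) valid.simps) (simp, blast)
    moreover have cl': "closed_arg (as_to_ax 0 t)"
      unfolding r[symmetric] using cl by (rule undischarged_subst)
    moreover have "concl (as_to_ax 0 t) = Or (At q1) (At q2)"
      using concl_subst[OF \<sigma>] r t(2) by simp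
    ultimately obtain s where "reduces H (as_to_ax 0 t) (Nd (Or (At q1) (At q2)) None [s])"
      "s \<in> DER ?Bp" "concl s = At q1 \<or> concl s = At q2"
      unfolding r by (rule valid_Or_atomsE)
    then show ?thesis using phi1_reduces[OF H(2) t(1,3,4) E'(3) False cl'] by blast
  qed
  then obtain r s where r: "reduces H (Nd ?S None [E']) (Nd ?S None [Nd ?I None [r]])"
    and s: "reduces H r (Nd (Or (At q1) (At q2)) None [s])" "s \<in> DER ?Bp"
      "concl s = At q1 \<or> concl s = At q2"
    by blast
  let ?V = "Nd (Imp (At p) (concl s)) None [ax_to_as (At p) 0 s]"
  \<comment> \<open>Here the extended base is left: \<open>s\<close> is a derivation over
    \<open>?Bp\<close>, but \<open>?V\<close> is valid over \<open>B\<close>.\<close>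
  note V = valid_Split_result[OF s(2,3)]
  have "reduces H (Nd ?S None [E]) (Nd ?S None [E'])"
    using E'(1) by (rule reduces_only_child)
  also note r
  also have "reduces H (Nd ?S None [Nd ?I None [r]])
      (Nd ?S None [Nd ?I None [Nd (Or (At q1) (At q2)) None [s]]])"
    using s(1) by (intro reduces_only_child)
  also have "reduces H \<dots> (Nd ?S None [?V])"
    using phi2_reduces[OF H(3) s(2,3)] .
  finally have red: "reduces H (Nd ?S None [E]) (Nd ?S None [?V])" .
  have "Nd ?S None [?V] \<in> or_intro"
    using V(1) s(3) by (intro or_intro_Nd) auto
  moreover have "immediate_subs (Nd ?S None [?V]) = [?V]"
    using inference_Nd[OF V(1)] by blast
  ultimately show ?thesis
    using E(2) V by (intro valid_closedI[OF _ _ red]) (auto simp: closed_arg_Nd canonical_def)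
qed

theorem theorem3:
  fixes p q1 q2 :: atom
  shows "logically_valid_rule (Split p q1 q2) {phi1 p q1 q2, phi2 p q1 q2}"
  unfolding logically_valid_rule_def valid_rule_on_def
proof (intro allI impI ballI)
  fix B H C D
  assume H: "{phi1 p q1 q2, phi2 p q1 q2} \<subseteq> H" "reductions H" and C: "atomic_base C"
    and D: "D \<in> Split p q1 q2" and sub: "\<forall>E\<in>set (immediate_subs D). valid C H E"
  let ?S = "Or (Imp (At p) (At q1)) (Imp (At p) (At q2))"
  from SplitE[OF D] obtain E where E: "D = Nd ?S None [E]"
    "concl E = Imp (At p) (Or (At q1) (At q2))" "arg_struct E" .
  have val: "valid C H E" using sub E by (simp add: release_arg_struct)
  show "valid C H D"
  proof (cases "closed_arg E")
    case True
    then show ?thesis unfolding E(1) using H C val E(2) by (intro valid_Split_closed) auto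
  next
    case False
    have "valid C' H' (subst \<sigma> D)"
      if "assignment E \<sigma>" "\<forall>A\<in>undischarged E. closed_arg (\<sigma> A)" "H \<subseteq> H'" "reductions H'"
        "C \<subseteq> C'" "atomic_base C'" "\<forall>A\<in>undischarged E. valid C' H' (\<sigma> A)" for \<sigma> H' C'
    proof -
      have "valid C' H' (subst \<sigma> E)"
        using val False that by (subst (asm) valid.simps) simp
      moreover have "closed_arg (subst \<sigma> E)" using that(2) undischarged_subst by blast
      moreover have "concl (subst \<sigma> E) = concl E" using that(1) by (rule concl_subst)
      \<comment> \<open>Substitution passes through the \<open>Split\<close> root, so the result is
        a closed \<open>Split\<close> step, handled with \<open>H'\<close> and \<open>C'\<close>;
        the two reductions are in \<open>H'\<close> because \<open>H\<close> is included in
        it.\<close>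
      ultimately show ?thesis
        unfolding E(1) using H that E(2) by simp (intro valid_Split_closed, auto)
    qed
    moreover have "\<not> closed_arg D" "undischarged D = undischarged E"
      "\<And>\<sigma>. assignment D \<sigma> = assignment E \<sigma>"
      using False E(1) by (auto simp: closed_arg_Nd assignment_def)
    ultimately show ?thesis by (subst valid.simps) simp
  qed
qed

end
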